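(* Let $\lambda \in \mathbb{R}$ and let $I$ be the $2\times 2$ identity matrix. If $\lambda \neq 0$, then $SP(I;\lambda)$ is a hyperboloid of one sheet. Also, $SP(I;0)$ is a right circular cone with vertex at the origin in $M_2$.
   Context: $M_2$ is the set of real $2\times 2$ matrices, identified with $\mathbb{R}^4$ by listing entries row-wise, with the usual inner product $\langle x,y\rangle = \operatorname{tr}(x^* y)$, where $x^*$ is the transpose of $x$. $\mathsf{S}_2$ is the set of singular matrices in $M_2$. For $a\in M_2$ and $\lambda\in\mathbb{R}$, $P(a;\lambda)=\{x\in M_2 : \operatorname{tr}(ax)=\lambda\}$ and $SP(a;\lambda)=P(a;\lambda)\cap \mathsf{S}_2$. Thus $P(I;\lambda)$ is a three-dimensional affine subspace of $\mathbb{R}^4$ with the induced Euclidean structure. A subset of a three-dimensional Euclidean affine space $H$ is a hyperboloid of one sheet if there are rectangular Cartesian (orthonormal) coordinates $(X,Y,Z)$ on $H$, with some origin in $H$, and reals $p,q,r>0$ such that the subset is the full solution set of $X^2/p^2+Y^2/q^2-Z^2/r^2=1$. It is a right circular cone with vertex $O$ if there are rectangular Cartesian coordinates $(X,Y,Z)$ on $H$ with origin $O$ and a real $k>0$ such that it is the full solution set of $X^2+Y^2=k^2Z^2$. *)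

theory Defs
  imports "HOL-Analysis.Analysis"
begin

text \<open>
  The space of real \<open>2 \<times> 2\<close> matrices is \<open>real^2^2\<close>, a vector of rows, so its library inner
  product is the Frobenius inner product:
\<close>

lemma inner_matrix_eq_trace:
  fixes x y :: "real^2^2"
  shows "inner x y = trace (transpose x ** y)"
  by (simp add: trace_def transpose_def matrix_matrix_mult_def inner_vec_def sum_2)

definition singular_matrices :: "(real^2^2) set" where
  "singular_matrices = {x. \<not> invertible x}"

definition trace_plane :: "real^2^2 \<Rightarrow> real \<Rightarrow> (real^2^2) set" where
  "trace_plane a \<mu> = {x. trace (a ** x) = \<mu>}"

definition singular_trace_plane :: "real^2^2 \<Rightarrow> real \<Rightarrow> (real^2^2) set" where
  "singular_trace_plane a \<mu> = trace_plane a \<mu> \<inter> singular_matrices"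

text \<open>
  Rectangular Cartesian coordinates on a three-dimensional affine subspace \<open>H\<close> are given by an
  origin \<open>c\<close> and an orthonormal triple \<open>u\<close>, \<open>v\<close>, \<open>w\<close> of axis directions; the point with coordinates
  \<open>(X, Y, Z)\<close> is \<open>c + X u + Y v + Z w\<close>. The equation for \<open>H\<close> forces it to be affine of dimension
  three.
\<close>

definition cartesian_frame :: "'a::real_inner set \<Rightarrow> 'a \<Rightarrow> 'a \<Rightarrow> 'a \<Rightarrow> 'a \<Rightarrow> bool" where
  "cartesian_frame H c u v w \<longleftrightarrow>
     norm u = 1 \<and> norm v = 1 \<and> norm w = 1 \<and>
     inner u v = 0 \<and> inner u w = 0 \<and> inner v w = 0 \<and>
     H = {c + X *\<^sub>R u + Y *\<^sub>R v + Z *\<^sub>R w | X Y Z. True}"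

lemma cartesian_frame_dim:
  fixes H :: "'a::euclidean_space set"
  assumes "cartesian_frame H c u v w"
  shows "affine H" and "aff_dim H = 3"
proof -
  have orth: "norm u = 1" "norm v = 1" "norm w = 1"
    "inner u v = 0" "inner u w = 0" "inner v w = 0"
    and H: "H = {c + X *\<^sub>R u + Y *\<^sub>R v + Z *\<^sub>R w | X Y Z. True}"
    using assms unfolding cartesian_frame_def by blast+
  have "span {u, v, w} = {X *\<^sub>R u + Y *\<^sub>R v + Z *\<^sub>R w | X Y Z. True}"
  proof -
    have "(x \<in> span {u, v, w}) = (\<exists>X Y Z. x = X *\<^sub>R u + Y *\<^sub>R v + Z *\<^sub>R w)" for x
      by (simp add: span_breakdown_eq) (simp add: algebra_simps)
    then show ?thesis by auto
  qed
  then have trans: "H = (+) c ` span {u, v, w}"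
    unfolding H by (force simp: add.assoc)
  then show "affine H"
    by (metis affine_translation subspace_imp_affine subspace_span)
  have neq: "u \<noteq> 0" "v \<noteq> 0" "w \<noteq> 0" "u \<noteq> v" "u \<noteq> w" "v \<noteq> w"
    using orth by auto
  then have "independent {u, v, w}"
    by (intro pairwise_orthogonal_independent)
      (use orth in \<open>auto simp: pairwise_def orthogonal_def inner_commute\<close>)
  then have "dim (span {u, v, w}) = 3"
    using neq by (simp add: dim_eq_card_independent)
  then show "aff_dim H = 3"
    using trans aff_dim_translation_eq aff_dim_subspace subspace_span by (metis of_nat_numeral)
qed

definition hyperboloid_of_one_sheet :: "'a::real_inner set \<Rightarrow> 'a set \<Rightarrow> bool" where
  "hyperboloid_of_one_sheet H S \<longleftrightarrow>
     (\<exists>c u v w p q r. cartesian_frame H c u v w \<and> p > 0 \<and> q > 0 \<and> r > 0 \<and>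
        S = {c + X *\<^sub>R u + Y *\<^sub>R v + Z *\<^sub>R w | X Y Z.
               X\<^sup>2 / p\<^sup>2 + Y\<^sup>2 / q\<^sup>2 - Z\<^sup>2 / r\<^sup>2 = (1::real)})"

definition right_circular_cone :: "'a::real_inner set \<Rightarrow> 'a \<Rightarrow> 'a set \<Rightarrow> bool" where
  "right_circular_cone H c S \<longleftrightarrow>
     (\<exists>u v w k. cartesian_frame H c u v w \<and> k > 0 \<and>
        S = {c + X *\<^sub>R u + Y *\<^sub>R v + Z *\<^sub>R w | X Y Z.
               X\<^sup>2 + Y\<^sup>2 = k\<^sup>2 * (Z::real)\<^sup>2})"

end

theory Submission
  imports Defs
begin

text \<open>
  In the orthonormal frame of the plane of trace \<open>\<mu>\<close> centred at \<open>(\<mu> / 2) I\<close>, with axes along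
  \<open>diag (1, -1)\<close>, the symmetric and the antisymmetric off-diagonal matrix, the determinant
  is \<open>\<mu>\<^sup>2 / 4 - (X\<^sup>2 + Y\<^sup>2 - Z\<^sup>2) / 2\<close>.
\<close>

definition mat2 :: "real \<Rightarrow> real \<Rightarrow> real \<Rightarrow> real \<Rightarrow> real^2^2" where
  "mat2 a b c d = vector [vector [a, b], vector [c, d]]"

lemma mat2_nth [simp]:
  "mat2 a b c d $ 1 $ 1 = a" "mat2 a b c d $ 1 $ 2 = b"
  "mat2 a b c d $ 2 $ 1 = c" "mat2 a b c d $ 2 $ 2 = d"
  by (simp_all add: mat2_def)

lemma mat2_eq_iff: "x = mat2 a b c d \<longleftrightarrow> x$1$1 = a \<and> x$1$2 = b \<and> x$2$1 = c \<and> x$2$2 = d"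
  by (auto simp: vec_eq_iff forall_2)

lemma inner_mat2: "inner (mat2 a b c d) (mat2 a' b' c' d') = a * a' + b * b' + c * c' + d * d'"
  by (simp add: inner_vec_def sum_2)

lemma mem_trace_plane_mat_1: "x \<in> trace_plane (mat 1) \<mu> \<longleftrightarrow> x$1$1 + x$2$2 = \<mu>"
  by (simp add: trace_plane_def trace_def sum_2)

lemma mem_singular_matrices: "x \<in> singular_matrices \<longleftrightarrow> x$1$1 * x$2$2 = x$1$2 * x$2$1"
  by (simp add: singular_matrices_def invertible_det_nz det_2)

text \<open>Kept as origin plus scaled axes, the literal shape used in
  \<open>cartesian_frame\<close>, so that unfolding it yields the required set descriptions. The
  factors \<open>1 / sqrt 2\<close> make the axes unit vectors.\<close>

definition trace_point :: "real \<Rightarrow> real \<Rightarrow> real \<Rightarrow> real \<Rightarrow> real^2^2" where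
  "trace_point \<mu> X Y Z = mat2 (\<mu> / 2) 0 0 (\<mu> / 2)
     + X *\<^sub>R mat2 (1 / sqrt 2) 0 0 (- (1 / sqrt 2))
     + Y *\<^sub>R mat2 0 (1 / sqrt 2) (1 / sqrt 2) 0
     + Z *\<^sub>R mat2 0 (1 / sqrt 2) (- (1 / sqrt 2)) 0"

lemma trace_point_eq:
  "trace_point \<mu> X Y Z =
     mat2 (\<mu> / 2 + X / sqrt 2) ((Y + Z) / sqrt 2) ((Y - Z) / sqrt 2) (\<mu> / 2 - X / sqrt 2)"
  by (simp add: mat2_eq_iff trace_point_def add_divide_distrib diff_divide_distrib)

lemma trace_plane_mat_1: "trace_plane (mat 1) \<mu> = {trace_point \<mu> X Y Z | X Y Z. True}"
proof -
  have "\<exists>X Y Z. x = trace_point \<mu> X Y Z" if "x$1$1 + x$2$2 = \<mu>" for x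
  proof (intro exI)
    \<comment> \<open>The witnesses are the inner products of \<open>x\<close> with the three axes;
      the origin is orthogonal to every axis, so it contributes nothing.\<close>
    show "x = trace_point \<mu> ((x$1$1 - x$2$2) / sqrt 2)
        ((x$1$2 + x$2$1) / sqrt 2) ((x$1$2 - x$2$1) / sqrt 2)"
      using that
      by (simp add: trace_point_eq mat2_eq_iff flip: add_divide_distrib diff_divide_distrib)
  qed
  then show ?thesis
    by (auto simp: mem_trace_plane_mat_1 trace_point_eq)
qed

text \<open>The diagonal and the off-diagonal entries each multiply to a difference of squares, and
  singularity says that the two products agree.\<close>

lemma trace_point_singular:
  "trace_point \<mu> X Y Z \<in> singular_matrices \<longleftrightarrow> X\<^sup>2 + Y\<^sup>2 - Z\<^sup>2 = \<mu>\<^sup>2 / 2"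
proof -
  have "(\<mu> / 2 + X / sqrt 2) * (\<mu> / 2 - X / sqrt 2) = \<mu>\<^sup>2 / 4 - X\<^sup>2 / 2"
    by (simp add: algebra_simps power2_eq_square)
  moreover have "(Y + Z) / sqrt 2 * ((Y - Z) / sqrt 2) = (Y\<^sup>2 - Z\<^sup>2) / 2"
    by (simp add: algebra_simps power2_eq_square)
  ultimately show ?thesis
    by (auto simp: mem_singular_matrices trace_point_eq)
qed

lemma singular_trace_plane_mat_1:
  "singular_trace_plane (mat 1) \<mu> = {trace_point \<mu> X Y Z | X Y Z. X\<^sup>2 + Y\<^sup>2 - Z\<^sup>2 = \<mu>\<^sup>2 / 2}"
  unfolding singular_trace_plane_def trace_plane_mat_1
  using trace_point_singular by blast

lemma cartesian_frame_trace_plane: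
  "cartesian_frame (trace_plane (mat 1) \<mu>) (mat2 (\<mu> / 2) 0 0 (\<mu> / 2))
     (mat2 (1 / sqrt 2) 0 0 (- (1 / sqrt 2)))
     (mat2 0 (1 / sqrt 2) (1 / sqrt 2) 0) (mat2 0 (1 / sqrt 2) (- (1 / sqrt 2)) 0)"
  unfolding cartesian_frame_def
  by (simp add: norm_eq_1 inner_mat2 trace_plane_mat_1 trace_point_def)

theorem proposition2:
  fixes \<mu> :: real
  shows "(\<mu> \<noteq> 0 \<longrightarrow>
            hyperboloid_of_one_sheet (trace_plane (mat 1) \<mu>) (singular_trace_plane (mat 1) \<mu>)) \<and>
         right_circular_cone (trace_plane (mat 1) 0) 0 (singular_trace_plane (mat 1) 0)"
proof (intro conjI impI)
  assume "\<mu> \<noteq> 0"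
  define p where "p = \<bar>\<mu>\<bar> / sqrt 2"
  have p: "p > 0" "p\<^sup>2 = \<mu>\<^sup>2 / 2"
    using \<open>\<mu> \<noteq> 0\<close> by (simp_all add: p_def power_divide)
  have eq: "X\<^sup>2 + Y\<^sup>2 - Z\<^sup>2 = \<mu>\<^sup>2 / 2 \<longleftrightarrow> X\<^sup>2 / p\<^sup>2 + Y\<^sup>2 / p\<^sup>2 - Z\<^sup>2 / p\<^sup>2 = 1" for X Y Z
    using p(1) unfolding p(2)[symmetric]
    by (auto simp flip: add_divide_distrib diff_divide_distrib)
  show "hyperboloid_of_one_sheet (trace_plane (mat 1) \<mu>) (singular_trace_plane (mat 1) \<mu>)"
    unfolding hyperboloid_of_one_sheet_def
    using cartesian_frame_trace_plane[of \<mu>] p(1)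
      singular_trace_plane_mat_1[of \<mu>, unfolded eq trace_point_def]
    by blast
next
  \<comment> \<open>At trace zero the origin of the frame is the zero matrix, which is the required
    vertex.\<close>
  have zero: "mat2 (0 / 2) 0 0 (0 / 2) = 0"
    by (simp add: mat2_eq_iff eq_commute[of _ 0])
  \<comment> \<open>The cone has slope \<open>k = 1\<close>. The unsimplified
    \<open>0\<^sup>2 / 2\<close> and \<open>1\<^sup>2\<close> match the instantiated lemma and the
    definition of the cone.\<close>
  have eq: "X\<^sup>2 + Y\<^sup>2 - Z\<^sup>2 = 0\<^sup>2 / 2 \<longleftrightarrow> X\<^sup>2 + Y\<^sup>2 = 1\<^sup>2 * Z\<^sup>2" for X Y Z :: real
    by simp
  show "right_circular_cone (trace_plane (mat 1) 0) 0 (singular_trace_plane (mat 1) 0)"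
    unfolding right_circular_cone_def
    using cartesian_frame_trace_plane[of 0, unfolded zero] zero_less_one
      singular_trace_plane_mat_1[of 0, unfolded eq trace_point_def zero]
    by blast
qed

end
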